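(* For all integers $n \geq 0$ we have $c(n) \geq \frac{4}{3} n - 4$, where $c(n)$ denotes the number of length-$n$ factors of the Thue-Morse word $\mathbf{t}$, counted up to cyclic rotation.
   Context: The Thue-Morse word is the infinite binary word $\mathbf{t} = t_0 t_1 t_2 \cdots = 01101001\cdots$, where $t_m$ is the parity of the number of $1$s in the binary representation of $m$. A length-$n$ factor of $\mathbf{t}$ is a word of the form $t_i t_{i+1} \cdots t_{i+n-1}$ for some $i \geq 0$. Two words $x,y$ are cyclically equivalent (equal up to cyclic rotation) if there are words $u,v$ (possibly empty) with $x = uv$ and $y = vu$. For $n \ge 0$, $c(n)$ is the number of cyclic-equivalence classes of words that contain at least one length-$n$ factor of $\mathbf{t}$; i.e., factors of length $n$ that are the same up to cyclic shift are counted once (so $c(0)=1$, $c(1)=2$, $c(2)=3$, $c(3)=2$, $c(4)=4$). *)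

theory Defs
  imports Complex_Main
begin

definition thue_morse :: "nat \<Rightarrow> nat" where
  "thue_morse m = card {k. bit m k} mod 2"

definition tm_factors :: "nat \<Rightarrow> nat list set" where
  "tm_factors n = {map thue_morse [i..<i + n] | i. True}"

definition cyclic_equiv :: "('a list \<times> 'a list) set" where
  "cyclic_equiv = {(x, y). \<exists>u v. x = u @ v \<and> y = v @ u}"

text \<open>The relation is not restricted to factors: each element of the quotient is the full
  conjugacy class of a length-\<open>n\<close> factor, which may also contain words that are not factors.\<close>

definition tm_cyclic_count :: "nat \<Rightarrow> nat" where
  "tm_cyclic_count n = card (tm_factors n // cyclic_equiv)"

lemma cyclic_equiv_iff_rotate: "(x, y) \<in> cyclic_equiv \<longleftrightarrow> (\<exists>k. y = rotate k x)"
proof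
  assume "(x, y) \<in> cyclic_equiv"
  then obtain u v where "x = u @ v" "y = v @ u" by (auto simp: cyclic_equiv_def)
  then have "y = rotate (length u) x" by (simp add: rotate_append)
  then show "\<exists>k. y = rotate k x" ..
next
  assume "\<exists>k. y = rotate k x"
  then obtain k where "y = drop (k mod length x) x @ take (k mod length x) x"
    by (auto simp: rotate_drop_take)
  moreover have "x = take (k mod length x) x @ drop (k mod length x) x" by simp
  ultimately show "(x, y) \<in> cyclic_equiv" unfolding cyclic_equiv_def by blast
qed

lemma equiv_cyclic_equiv: "equiv UNIV cyclic_equiv"
proof (rule equivI)
  show "refl cyclic_equiv" by (auto simp: refl_on_def cyclic_equiv_def)
  show "sym cyclic_equiv" by (auto simp: sym_def cyclic_equiv_def)
  show "trans cyclic_equiv"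
    by (rule transI) (auto simp: cyclic_equiv_iff_rotate rotate_rotate)
qed simp

lemma finite_tm_factors: "finite (tm_factors n)"
proof (rule finite_subset)
  show "tm_factors n \<subseteq> {xs. set xs \<subseteq> {0, 1} \<and> length xs = n}"
    by (auto simp: tm_factors_def thue_morse_def)
  show "finite {xs. set xs \<subseteq> {0, 1::nat} \<and> length xs = n}"
    by (rule finite_lists_length_eq) simp
qed

lemma finite_tm_factors_quotient: "finite (tm_factors n // cyclic_equiv)"
  unfolding quotient_def using finite_tm_factors by auto

end

(*
  Cut a factor of the Thue-Morse word t into the blocks 01 and 10; the parity of the cut is unique
  as soon as the factor has length at least 5. Let d(m) and e(m) count the factors of length m + 1
  whose first and last letters differ, respectively agree. Desubstitution gives, for r >= 2,
    d(2r) = 2 d(r),  d(2r+1) = e(r) + e(r+1),  e(2r) = 2 e(r),  e(2r+1) = d(r) + d(r+1),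
  and by induction 3 d(m) >= 4 m, e(m) >= m and d(m) + e(m) >= 3 m.

  Even lengths: c(2m) >= c(m) + d(m) for m >= 5. The images of inequivalent words of length m are
  inequivalent, and every odd-aligned factor coming from a word counted by d(m) is alone in its class, because
  closing it up to a circle creates exactly one defect of alignment, which has to be the cut.

  Odd lengths: two conjugate factors of odd length are joined by one-letter rotations through
  factors. So each class contains at most one factor x whose rotation by one letter is not a factor,
  and c(n) is at least the number of all factors minus the number of pairs x, rotate1 x of factors.
  These pairs again satisfy a recurrence by desubstitution, which bounds them in terms of d and e.
*)
theory Submission
  imports Defs
begin

section \<open>Aligned occurrences in the Thue-Morse word\<close>

definition tm :: "nat \<Rightarrow> bool" where
  "tm i \<longleftrightarrow> thue_morse i = 1"

text \<open>\<open>occ p w\<close>: the word \<open>w\<close> occurs at a position whose oddness is \<open>p\<close>.\<close>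

definition occ :: "bool \<Rightarrow> bool list \<Rightarrow> bool" where
  "occ p w \<longleftrightarrow> (\<exists>i. odd i = p \<and> map tm [i..<i + length w] = w)"

definition factor :: "bool list \<Rightarrow> bool" where
  "factor w \<longleftrightarrow> (\<exists>p. occ p w)"

text \<open>The Thue-Morse morphism 0 -> 01, 1 -> 10; \<open>morph_map_tm\<close> below says that it
  fixes t.\<close>

fun morph :: "bool list \<Rightarrow> bool list" where
  "morph [] = []"
| "morph (a # w) = a # (\<not> a) # morph w"

section \<open>The Thue-Morse word under doubling of the index\<close>

lemma thue_morse_double: "thue_morse (2 * i) = thue_morse i"
proof -
  have "k \<in> {k. bit (2 * i) k} \<longleftrightarrow> k \<in> Suc ` {k. bit i k}" for k
    by (cases k) (auto simp: bit_0 bit_Suc)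
  then have "{k. bit (2 * i) k} = Suc ` {k. bit i k}" by blast
  then show ?thesis by (simp add: thue_morse_def card_image)
qed

lemma thue_morse_double_Suc: "thue_morse (Suc (2 * i)) = 1 - thue_morse i"
proof -
  have "k \<in> {k. bit (Suc (2 * i)) k} \<longleftrightarrow> k \<in> insert 0 (Suc ` {k. bit i k})" for k
    by (cases k) (auto simp: bit_0 bit_Suc)
  then have "{k. bit (Suc (2 * i)) k} = insert 0 (Suc ` {k. bit i k})" by blast
  moreover have "finite {k. bit i k}"
  proof (rule finite_subset)
    show "{k. bit i k} \<subseteq> {..<i}"
    proof (clarsimp simp: bit_iff_odd)
      fix k
      assume "odd (i div 2 ^ k)"
      then have "i div 2 ^ k \<noteq> 0" by (metis even_zero)
      then have "2 ^ k \<le> i" by (simp add: div_eq_0_iff)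
      then show "k < i" using less_exp[of k] by linarith
    qed
  qed simp
  ultimately show ?thesis
    by (simp add: thue_morse_def card_image card_insert_if mod_Suc)
qed

lemma thue_morse_le: "thue_morse i < 2"
  by (simp add: thue_morse_def)

lemma tm_double [simp]: "tm (2 * i) = tm i"
  by (simp add: tm_def thue_morse_double)

lemma tm_double_Suc [simp]: "tm (Suc (2 * i)) = (\<not> tm i)"
  using thue_morse_le[of i] by (auto simp: tm_def thue_morse_double_Suc)

lemma tm_0 [simp]: "tm 0 = False" and tm_1 [simp]: "tm (Suc 0) = True"
  using tm_double_Suc[of 0] by (auto simp: tm_def thue_morse_def)

text \<open>With this rule and the next, simplification evaluates \<open>tm\<close> at numerals,
  which settles the later checks at explicit positions.\<close>

lemma tm_Bit0 [simp]: "tm (numeral (num.Bit0 k)) = tm (numeral k)"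
  using tm_double[of "numeral k"] by simp

lemma tm_Bit1 [simp]: "tm (numeral (num.Bit1 k)) = (\<not> tm (numeral k))"
  using tm_double_Suc[of "numeral k"] by (simp add: numeral_Bit1 numeral_Bit0)

lemma length_morph [simp]: "length (morph w) = 2 * length w"
  by (induction w) auto

lemma morph_append [simp]: "morph (v @ w) = morph v @ morph w"
  by (induction v) auto

lemma morph_eq_Nil_iff [simp]: "morph w = [] \<longleftrightarrow> w = []"
  by (cases w) auto

lemma morph_inject [simp]: "morph v = morph w \<longleftrightarrow> v = w"
proof (induction v arbitrary: w)
  case Nil
  then show ?case by (cases w) auto
next
  case (Cons a v)
  then show ?case by (cases w) auto
qed

lemma morph_map_tm: "morph (map tm [i..<i + k]) = map tm [2 * i..<2 * i + 2 * k]"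
proof (induction k)
  case (Suc k)
  then show ?case using tm_double[of "i + k"] tm_double_Suc[of "i + k"] by simp
qed simp

text \<open>Alignments add like parities: \<open>p \<noteq> odd (length v)\<close> is the exclusive
  or of \<open>p\<close> and the parity of the skipped length.\<close>

lemma occ_append:
  assumes "occ p (v @ w)"
  shows "occ p v" and "occ (p \<noteq> odd (length v)) w"
proof -
  obtain i where i: "odd i = p" "map tm [i..<i + (length v + length w)] = v @ w"
    using assms by (auto simp: occ_def)
  have "[i..<i + (length v + length w)] = [i..<i + length v] @ [i + length v..<i + length v + length w]"
    using upt_add_eq_append[of i "i + length v" "length w"] by (simp add: add.assoc)
  with i(2) have "map tm [i..<i + length v] = v" "map tm [i + length v..<i + length v + length w] = w"
    by simp_all
  moreover have "odd (i + length v) = (p \<noteq> odd (length v))"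
    using i(1) by auto
  ultimately show "occ p v" "occ (p \<noteq> odd (length v)) w"
    using i(1) unfolding occ_def by blast+
qed

lemma occ_Cons: "occ p (a # w) \<Longrightarrow> occ (\<not> p) w"
  using occ_append(2)[of p "[a]" w] by simp

text \<open>An even position starts a block, and the two letters of a block are
  complementary.\<close>

lemma occ_block: "occ False (a # b # w) \<Longrightarrow> b = (\<not> a)"
proof -
  assume "occ False (a # b # w)"
  then obtain j where "map tm [2 * j..<2 * j + length (a # b # w)] = a # b # w"
    unfolding occ_def by (metis evenE)
  then show ?thesis by (auto simp: upt_conv_Cons simp del: upt_Suc)
qed

lemma occ_block_append:
  "occ p (v @ a # b # w) \<Longrightarrow> odd (length v) = p \<Longrightarrow> b = (\<not> a)"
  using occ_append(2)[of p v "a # b # w"] occ_block by auto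

lemma factor_appendD:
  assumes "factor (v @ w)" shows "factor v" "factor w"
proof -
  obtain p where "occ p (v @ w)" using assms by (auto simp: factor_def)
  from occ_append[OF this] show "factor v" "factor w" by (auto simp: factor_def)
qed

lemma factor_tl: "factor w \<Longrightarrow> factor (tl w)"
  by (cases w) (auto simp: factor_def dest: occ_Cons)

lemma factor_butlast: "factor w \<Longrightarrow> factor (butlast w)"
  by (cases w rule: rev_cases) (auto dest: factor_appendD)

lemma occ_morph [simp]: "factor w \<Longrightarrow> occ False (morph w)"
proof -
  assume "factor w"
  then obtain i where "map tm [i..<i + length w] = w"
    by (auto simp: factor_def occ_def)
  then have "map tm [2 * i..<2 * i + length (morph w)] = morph w"
    by (metis length_morph morph_map_tm)
  then show ?thesis unfolding occ_def by (metis even_mult_iff even_numeral)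
qed

lemma occ_tl: "occ p w \<Longrightarrow> w \<noteq> [] \<Longrightarrow> occ (\<not> p) (tl w)"
  by (cases w) (auto dest: occ_Cons)

lemma occ_butlast: "occ p w \<Longrightarrow> occ p (butlast w)"
  by (cases w rule: rev_cases) (auto dest: occ_append)

text \<open>Desubstitution when both ends of the word lie on block boundaries. The variants
  \<open>occ_False_odd\<close>, \<open>occ_True_odd\<close> and \<open>occ_True_even\<close> first
  complete the blocks cut at the ends.\<close>

lemma occ_False_even:
  assumes "occ False w" "even (length w)"
  obtains z where "factor z" "w = morph z"
proof -
  obtain i where "even i" and w: "map tm [i..<i + length w] = w"
    using assms(1) by (auto simp: occ_def)
  from \<open>even i\<close> obtain j where j: "i = 2 * j" by (rule evenE)
  from assms(2) obtain k where k: "length w = 2 * k" by (rule evenE)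
  from w have "w = map tm [2 * j..<2 * j + 2 * k]"
    unfolding j k by (rule sym)
  then have "w = morph (map tm [j..<j + k])"
    by (simp only: morph_map_tm)
  moreover have "factor (map tm [j..<j + k])"
    unfolding factor_def occ_def by (intro exI[of _ "odd j"] exI[of _ j]) simp
  ultimately show ?thesis by (intro that)
qed

lemma occ_extend_right:
  assumes "occ p w"
  obtains a where "occ p (w @ [a])"
proof -
  obtain i where i: "odd i = p" "map tm [i..<i + length w] = w"
    using assms by (auto simp: occ_def)
  then have "map tm [i..<i + length (w @ [tm (i + length w)])] = w @ [tm (i + length w)]"
    by simp
  with i(1) have "occ p (w @ [tm (i + length w)])"
    unfolding occ_def by (intro exI[of _ i] conjI)
  then show ?thesis by (rule that)
qed

text \<open>An odd position has a predecessor, unlike position 0.\<close>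

lemma occ_True_extend_left:
  assumes "occ True w"
  obtains a where "occ False (a # w)"
proof -
  obtain i where i: "odd i" "map tm [i..<i + length w] = w"
    using assms by (auto simp: occ_def)
  then obtain j where j: "i = Suc j" "even j"
    by (cases i) auto
  with i(2) have "map tm [j..<j + length (tm j # w)] = tm j # w"
    by (simp add: upt_conv_Cons del: upt_Suc)
  with j(2) have "occ False (tm j # w)"
    unfolding occ_def by (intro exI[of _ j] conjI) auto
  then show ?thesis by (rule that)
qed

lemma occ_False_odd:
  assumes "occ False w" "odd (length w)"
  obtains z where "factor z" "w = butlast (morph z)"
proof -
  obtain a where "occ False (w @ [a])" using assms(1) by (rule occ_extend_right)
  moreover have "even (length (w @ [a]))" using assms(2) by simp
  ultimately obtain z where "factor z" "w @ [a] = morph z" by (rule occ_False_even)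
  with that show ?thesis by (metis butlast_snoc)
qed

lemma occ_True_odd:
  assumes "occ True w" "odd (length w)"
  obtains z where "factor z" "w = tl (morph z)"
proof -
  obtain a where "occ False (a # w)" using assms(1) by (rule occ_True_extend_left)
  moreover have "even (length (a # w))" using assms(2) by simp
  ultimately obtain z where "factor z" "a # w = morph z" by (rule occ_False_even)
  with that show ?thesis by (metis list.sel(3))
qed

lemma occ_True_even:
  assumes "occ True w" "even (length w)"
  obtains z where "factor z" "w = tl (butlast (morph z))"
proof -
  obtain a where "occ False (a # w)" using assms(1) by (rule occ_True_extend_left)
  moreover have "odd (length (a # w))" using assms(2) by simp
  ultimately obtain z where "factor z" "a # w = butlast (morph z)" by (rule occ_False_odd)
  with that show ?thesis by (metis list.sel(3))
qed

section \<open>Forbidden factors and uniqueness of the alignment\<close>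

lemma not_factor_cube: "\<not> factor [a, a, a]"
proof
  assume "factor [a, a, a]"
  then obtain p where "occ p [a, a, a]" by (auto simp: factor_def)
  then show False
    using occ_block[of a a "[a]"] occ_Cons[of True a "[a, a]"] occ_block[of a a "[]"]
    by (cases p) auto
qed

text \<open>In either alignment, desubstitution produces a cube of one letter.\<close>

lemma not_factor_alternating: "\<not> factor [a, \<not> a, a, \<not> a, a]"
proof
  assume "factor [a, \<not> a, a, \<not> a, a]"
  then consider "occ False [a, \<not> a, a, \<not> a, a]" | "occ True [a, \<not> a, a, \<not> a, a]"
    unfolding factor_def by (metis (full_types))
  then show False
  proof cases
    case 1
    then obtain z where "factor z" "[a, \<not> a, a, \<not> a, a] = butlast (morph z)"
      by (rule occ_False_odd) auto
    moreover from this have "length z = 3" by (auto dest!: arg_cong[where f = length])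
    ultimately show False using not_factor_cube[of a]
      by (auto simp: numeral_3_eq_3 length_Suc_conv)
  next
    case 2
    then obtain z where "factor z" "[a, \<not> a, a, \<not> a, a] = tl (morph z)"
      by (rule occ_True_odd) auto
    moreover from this have "length z = 3" by (auto dest!: arg_cong[where f = length])
    ultimately show False using not_factor_cube[of "\<not> a"]
      by (auto simp: numeral_3_eq_3 length_Suc_conv)
  qed
qed

text \<open>Two adjacent letters form a block in one of the two occurrences, so the word alternates,
  and \<open>not_factor_alternating\<close> caps its length at 4.\<close>

lemma occ_both_cases:
  assumes "occ False w" "occ True w"
  obtains "w = []" | a where "w = [a]" | a where "w = [a, \<not> a]" | a where "w = [a, \<not> a, a]"
    | a where "w = [a, \<not> a, a, \<not> a]"
proof -
  have step: "b = (\<not> a) \<and> occ False (b # v) \<and> occ True (b # v)"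
    if "occ False (a # b # v)" "occ True (a # b # v)" for a b v
    using that occ_block[of a b v] occ_Cons[of False a] occ_Cons[of True a] by auto
  consider "w = []" | a where "w = [a]" | a b where "w = [a, b]" | a b c where "w = [a, b, c]"
    | a b c d where "w = [a, b, c, d]" | a b c d e v where "w = a # b # c # d # e # v"
    by (metis list.exhaust)
  then show ?thesis
  proof cases
    case 6
    then have "b = (\<not> a)" "c = (\<not> b)" "d = (\<not> c)" "e = (\<not> d)"
      using assms by (auto dest: step)
    with 6 have "w = [a, \<not> a, a, \<not> a, a] @ v" by simp
    then have "factor [a, \<not> a, a, \<not> a, a]"
      using assms(1) factor_appendD(1)[of "[a, \<not> a, a, \<not> a, a]" v] unfolding factor_def by auto
    then show ?thesis using not_factor_alternating by blast
  next
    case 3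
    then show ?thesis using assms that(3) by (auto dest: step)
  next
    case 4
    then have "b = (\<not> a)" "c = (\<not> b)" using assms by (auto dest: step)
    then show ?thesis using 4 that(4) by simp
  next
    case 5
    then have "b = (\<not> a)" "c = (\<not> b)" "d = (\<not> c)" using assms by (auto dest: step)
    then show ?thesis using 5 that(5) by simp
  qed (use that in blast)+
qed

text \<open>This synchronization property lets even-aligned and odd-aligned factors be counted
  separately.\<close>

lemma occ_both_length: "occ False w \<Longrightarrow> occ True w \<Longrightarrow> length w \<le> 4"
  by (erule (1) occ_both_cases) auto

section \<open>Recurrences for the counts\<close>

text \<open>\<open>card (ends True m)\<close> is d(m) and \<open>card (ends False m)\<close> is e(m). \<open>exts False m\<close> corresponds to the
  factors \<open>b # y\<close> of length \<open>m + 1\<close> whose rotation \<open>y @ [b]\<close> is also a factor; desubstitution exchanges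
  it with \<open>exts True\<close>.\<close>

definition ends :: "bool \<Rightarrow> nat \<Rightarrow> bool list set" where
  "ends q m = {z. factor z \<and> length z = Suc m \<and> (hd z \<noteq> last z) = q}"

definition exts :: "bool \<Rightarrow> nat \<Rightarrow> (bool list \<times> bool) set" where
  "exts q m = {(y, b). length y = m \<and> factor ((q \<noteq> b) # y) \<and> factor (y @ [b])}"

lemma finite_length_eq: "finite {w :: bool list. length w = n}"
  using finite_lists_length_eq[of "UNIV :: bool set" n] by simp

lemma finite_ends [simp]: "finite (ends q m)"
  by (rule finite_subset[OF _ finite_length_eq[of "Suc m"]]) (auto simp: ends_def)

lemma finite_exts [simp]: "finite (exts q m)"
  by (rule finite_subset[OF _ finite_cartesian_product[OF finite_length_eq[of m] finite_UNIV]])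
    (auto simp: exts_def)

lemma factor_imp_occ_tl: "factor z \<Longrightarrow> z \<noteq> [] \<Longrightarrow> occ True (tl (morph z))"
  using occ_tl[of False "morph z"] by simp

lemma factor_imp_occ_tl_butlast:
  "factor z \<Longrightarrow> z \<noteq> [] \<Longrightarrow> occ True (tl (butlast (morph z)))"
  using occ_butlast[OF factor_imp_occ_tl] by (simp add: butlast_tl)

lemma factor_morph: "factor z \<Longrightarrow> factor (morph z)"
  using occ_morph factor_def by blast

lemma hd_butlast': "2 \<le> length z \<Longrightarrow> hd (butlast z) = hd z"
  by (cases z; cases "tl z") auto

lemma hd_morph [simp]: "z \<noteq> [] \<Longrightarrow> hd (morph z) = hd z"
  by (cases z) auto

lemma last_morph [simp]: "z \<noteq> [] \<Longrightarrow> last (morph z) = (\<not> last z)"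
  by (cases z rule: rev_cases) auto

lemma tl_morph: "z \<noteq> [] \<Longrightarrow> tl (morph z) = (\<not> hd z) # morph (tl z)"
  by (cases z) auto

lemma butlast_morph: "z \<noteq> [] \<Longrightarrow> butlast (morph z) = morph (butlast z) @ [last z]"
  by (cases z rule: rev_cases) (auto simp: butlast_append)

lemma tl_butlast_morph:
  "2 \<le> length z \<Longrightarrow> tl (butlast (morph z)) = (\<not> hd z) # morph (butlast (tl z)) @ [last z]"
  by (cases z) (auto simp: butlast_morph)

text \<open>A block that loses one letter is determined by the other. This also gives the next two
  injectivity lemmas; cutting at both ends needs length 2, so that the lost letters lie in different
  blocks.\<close>

lemma inj_on_tl_morph: "inj_on (\<lambda>z. tl (morph z)) {z. z \<noteq> []}"
proof (rule inj_onI)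
  fix x y :: "bool list"
  assume "x \<in> {z. z \<noteq> []}" "y \<in> {z. z \<noteq> []}" "tl (morph x) = tl (morph y)"
  then show "x = y" by (cases x; cases y) auto
qed

lemma butlast_last_eqI:
  "v \<noteq> [] \<Longrightarrow> w \<noteq> [] \<Longrightarrow> butlast v = butlast w \<Longrightarrow> last v = last w \<Longrightarrow> v = w"
  by (metis append_butlast_last_id)

lemma inj_on_butlast_morph: "inj_on (\<lambda>z. butlast (morph z)) {z. z \<noteq> []}"
proof (rule inj_onI)
  fix x y :: "bool list"
  assume "x \<in> {z. z \<noteq> []}" "y \<in> {z. z \<noteq> []}" "butlast (morph x) = butlast (morph y)"
  then show "x = y" by (cases x rule: rev_cases; cases y rule: rev_cases) (auto simp: butlast_append)
qed

lemma inj_on_tl_butlast_morph: "inj_on (\<lambda>z. tl (butlast (morph z))) {z. 2 \<le> length z}"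
proof (rule inj_onI)
  fix x y :: "bool list"
  assume len: "x \<in> {z. 2 \<le> length z}" "y \<in> {z. 2 \<le> length z}"
    and "tl (butlast (morph x)) = tl (butlast (morph y))"
  then have eq: "hd x = hd y" "butlast (tl x) = butlast (tl y)" "last x = last y"
    by (auto simp: tl_butlast_morph)
  have ne: "x \<noteq> []" "tl x \<noteq> []" "y \<noteq> []" "tl y \<noteq> []"
    using len by (auto simp: tl_Nil)
  have "tl x = tl y"
    by (rule butlast_last_eqI) (use eq ne in \<open>auto simp: last_tl\<close>)
  with eq(1) ne(1,3) show "x = y" by (simp add: list.expand)
qed

lemma card_ends_disjoint:
  assumes "4 \<le> m" "\<And>z. z \<in> A \<Longrightarrow> occ False (f z)" "\<And>z. z \<in> B \<Longrightarrow> occ True (g z)"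
    "f ` A \<union> g ` B \<subseteq> ends q m" "inj_on f A" "inj_on g B"
  shows "card A + card B \<le> card (ends q m)"
proof -
  have fin: "finite (f ` A)" "finite (g ` B)"
    using assms(4) finite_subset[OF _ finite_ends] by blast+
  have "f ` A \<inter> g ` B = {}"
  proof (rule ccontr)
    assume "f ` A \<inter> g ` B \<noteq> {}"
    then obtain x y where xy: "x \<in> A" "y \<in> B" "f x = g y" by blast
    then have "occ False (f x)" "occ True (f x)" "f x \<in> ends q m"
      using assms(2)[of x] assms(3)[of y] assms(4) by auto
    then show False using occ_both_length[of "f x"] assms(1) by (simp add: ends_def)
  qed
  then have "card (f ` A \<union> g ` B) = card A + card B"
    using fin assms(5,6) by (simp add: card_Un_disjoint card_image)
  then show ?thesis using card_mono[OF finite_ends assms(4)] by simp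
qed

text \<open>Length \<open>2 * r + 1\<close> arises from the image of \<open>r + 1\<close> letters by
  dropping its last or its first letter. The end letters are then those of \<open>z\<close>, or both
  complemented, so \<open>q\<close> is kept.\<close>

lemma card_ends_double:
  assumes "2 \<le> r"
  shows "2 * card (ends q r) \<le> card (ends q (2 * r))"
proof -
  have len: "z \<noteq> [] \<and> tl z \<noteq> [] \<and> butlast z \<noteq> []" if "z \<in> ends q r" for z
    using that assms by (cases z; cases "tl z") (auto simp: ends_def)
  have "card (ends q r) + card (ends q r) \<le> card (ends q (2 * r))"
  proof (rule card_ends_disjoint)
    show "(\<lambda>z. butlast (morph z)) ` ends q r \<union> (\<lambda>z. tl (morph z)) ` ends q r \<subseteq> ends q (2 * r)"
    proof -
      have "butlast (morph z) \<in> ends q (2 * r)" "tl (morph z) \<in> ends q (2 * r)"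
        if z: "z \<in> ends q r" for z
        using z len[OF z] assms factor_butlast[OF factor_morph, of z] factor_tl[OF factor_morph, of z]
        by (auto simp: ends_def butlast_morph tl_morph hd_append last_tl hd_butlast')
      then show ?thesis by blast
    qed
    show "inj_on (\<lambda>z. butlast (morph z)) (ends q r)" "inj_on (\<lambda>z. tl (morph z)) (ends q r)"
      using len by (blast intro: inj_on_subset[OF inj_on_butlast_morph] inj_on_subset[OF inj_on_tl_morph])+
  qed (use assms len in \<open>auto intro!: occ_butlast factor_imp_occ_tl simp: ends_def\<close>)
  then show ?thesis by simp
qed

text \<open>Length \<open>2 * r + 2\<close> is a full image of \<open>r + 1\<close> letters, or an
  image of \<open>r + 2\<close> letters cut at both ends. In each case exactly one end letter is
  complemented, which negates \<open>q\<close>.\<close>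

lemma card_ends_double_Suc:
  assumes "2 \<le> r"
  shows "card (ends (\<not> q) r) + card (ends (\<not> q) (Suc r)) \<le> card (ends q (Suc (2 * r)))"
proof (rule card_ends_disjoint)
  have 1: "morph z \<in> ends q (Suc (2 * r))" if "z \<in> ends (\<not> q) r" for z
    using that factor_morph[of z] by (cases "z = []") (auto simp: ends_def)
  have 2: "tl (butlast (morph z)) \<in> ends q (Suc (2 * r))" if "z \<in> ends (\<not> q) (Suc r)" for z
    using that factor_tl[OF factor_butlast[OF factor_morph], of z]
    by (auto simp: ends_def tl_butlast_morph)
  show "morph ` ends (\<not> q) r \<union> (\<lambda>z. tl (butlast (morph z))) ` ends (\<not> q) (Suc r) \<subseteq> ends q (Suc (2 * r))"
    using 1 2 by blast
  show "inj_on (\<lambda>z. tl (butlast (morph z))) (ends (\<not> q) (Suc r))"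
    by (rule inj_on_subset[OF inj_on_tl_butlast_morph]) (auto simp: ends_def)
qed (use assms in \<open>auto intro!: factor_imp_occ_tl_butlast inj_onI simp: ends_def\<close>)

text \<open>Otherwise \<open>y\<close> would have both alignments, hence be alternating of length 4,
  and the block containing \<open>c\<close> or \<open>b\<close> would prolong it to a forbidden
  alternating word of length 5.\<close>

lemma occ_around:
  assumes "occ p (c # y)" "occ q (y @ [b])" "4 \<le> length y"
  shows "p = (\<not> q)"
proof (rule ccontr)
  assume "p \<noteq> (\<not> q)"
  then have [simp]: "q = p" by simp
  have y: "occ False y" "occ True y"
    using occ_Cons[OF assms(1)] occ_append(1)[OF assms(2)] by (cases p; simp)+
  then obtain a where a: "y = [a, \<not> a, a, \<not> a]"
    by (rule occ_both_cases) (use assms(3) in auto)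
  have "factor (c # y)" "factor (y @ [b])" using assms(1,2) by (auto simp: factor_def)
  moreover have "c = (\<not> a) \<or> b = a"
    using assms(1,2) a occ_block[of c a] occ_block_append[of True "[a, \<not> a, a]" "\<not> a" b "[]"]
    by (cases p) auto
  ultimately show False
    using not_factor_alternating[of a] not_factor_alternating[of "\<not> a"] a by auto
qed

lemma card_exts_double:
  assumes "2 \<le> r"
  shows "card (exts q (2 * r)) \<le> card (exts (\<not> q) r) + card (ends (\<not> q) r)"
proof -
  let ?f = "\<lambda>(v, b). (morph v, b)"
  let ?g = "\<lambda>z. (tl (butlast (morph z)), \<not> last z)"
  have "exts q (2 * r) \<subseteq> ?f ` exts (\<not> q) r \<union> ?g ` ends (\<not> q) r"
  proof (rule subrelI, rule UnCI)
    fix y b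
    assume yb: "(y, b) \<in> exts q (2 * r)" "(y, b) \<notin> ?g ` ends (\<not> q) r"
    obtain p s where occ: "occ p ((q \<noteq> b) # y)" "occ s (y @ [b])" and len: "length y = 2 * r"
      using yb(1) by (auto simp: exts_def factor_def)
    have p: "p = (\<not> s)" using occ_around[OF occ] len assms by simp
    show "(y, b) \<in> ?f ` exts (\<not> q) r"
    proof (cases s)
      \<comment> \<open>\<open>y\<close> starts at an even position in both occurrences, so it is an
        image \<open>morph v\<close>. The letter before it is the complement of the letter before
        \<open>v\<close>, which negates \<open>q\<close>.\<close>
      case False
      obtain z where z: "factor z" "y @ [b] = butlast (morph z)"
        by (rule occ_False_odd[of "y @ [b]"]) (use occ(2) len False in auto)
      then have "z \<noteq> []" by auto
      with z have y: "y = morph (butlast z)" "b = last z" by (auto simp: butlast_morph)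
      obtain z' where z': "factor z'" "(q \<noteq> b) # y = tl (morph z')"
        by (rule occ_True_odd[of "(q \<noteq> b) # y"]) (use occ(1) len p False in auto)
      then have "z' \<noteq> []" by auto
      with z' have "y = morph (tl z')" "hd z' = (q = b)" by (auto simp: tl_morph)
      with y have "tl z' = butlast z" by simp
      with \<open>hd z' = (q = b)\<close> \<open>z' \<noteq> []\<close> have "z' = (q = b) # butlast z" by (cases z') auto
      with z'(1) have "factor ((q = b) # butlast z)" by simp
      moreover have "factor (butlast z @ [b])" using z(1) \<open>z \<noteq> []\<close> y(2) by simp
      moreover have "length (butlast z) = r"
        using arg_cong[OF y(1), of length] len by simp
      ultimately have "(butlast z, b) \<in> exts (\<not> q) r"
        by (simp add: exts_def)
      then show ?thesis using y(1) by (intro image_eqI[of _ _ "(butlast z, b)"]) simp_all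
    next
      \<comment> \<open>\<open>y\<close> starts inside a block in both occurrences, so both
        extensions complete cut blocks of one word \<open>z\<close>: the first letter is
        \<open>hd z\<close>, and \<open>b\<close> is the complement of
        \<open>last z\<close>.\<close>
      case True
      obtain z where z: "factor z" "(q \<noteq> b) # y = butlast (morph z)"
        by (rule occ_False_odd[of "(q \<noteq> b) # y"]) (use occ(1) len p True in auto)
      obtain z' where z': "factor z'" "y @ [b] = tl (morph z')"
        by (rule occ_True_odd[of "y @ [b]"]) (use occ(2) len True in auto)
      have y: "y = tl (butlast (morph z))" "y = tl (butlast (morph z'))"
        using arg_cong[OF z(2), of tl] arg_cong[OF z'(2), of butlast] by (auto simp: butlast_tl)
      have lz: "length z = Suc r" "length z' = Suc r"
        using z z' len by (auto dest!: arg_cong[where f = length])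
      have "tl (butlast (morph z)) = tl (butlast (morph z'))" using y by simp
      then have "z = z'"
        by (rule inj_onD[OF inj_on_tl_butlast_morph]) (use lz assms in auto)
      have "z \<noteq> []" using lz by auto
      have "hd z = (q \<noteq> b)"
        using arg_cong[OF z(2), of hd] lz assms \<open>z \<noteq> []\<close>
        by (cases z; cases "tl z") auto
      moreover have "b = (\<not> last z)"
        using arg_cong[OF z'(2), of last] lz assms \<open>z \<noteq> []\<close> \<open>z = z'\<close>
        by (cases z; cases "tl z") (auto split: if_splits)
      ultimately have "z \<in> ends (\<not> q) r" "(y, b) = ?g z"
        using lz z(1) y by (auto simp: ends_def)
      then show ?thesis using yb(2) by blast
    qed
  qed
  then have "card (exts q (2 * r)) \<le> card (?f ` exts (\<not> q) r \<union> ?g ` ends (\<not> q) r)"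
    by (intro card_mono) auto
  also have "\<dots> \<le> card (?f ` exts (\<not> q) r) + card (?g ` ends (\<not> q) r)"
    by (rule card_Un_le)
  also have "\<dots> \<le> card (exts (\<not> q) r) + card (ends (\<not> q) r)"
    by (intro add_mono card_image_le) auto
  finally show ?thesis .
qed

text \<open>One of the two extended words consists of whole blocks, and the letter added on the
  other side lies in one further block. All this desubstitutes to one word of length
  \<open>r + 2\<close>, from which \<open>?f\<close> or \<open>?g\<close> recovers the pair; hence
  the factor 2.\<close>

lemma card_exts_double_Suc:
  assumes "2 \<le> r"
  shows "card (exts q (Suc (2 * r))) \<le> 2 * card (ends q (Suc r))"
proof -
  let ?f = "\<lambda>z. (butlast (morph (tl z)), q = hd z)"
  let ?g = "\<lambda>z. (tl (morph (butlast z)), last z)"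
  have "exts q (Suc (2 * r)) \<subseteq> ?f ` ends q (Suc r) \<union> ?g ` ends q (Suc r)"
  proof (rule subrelI, rule UnCI)
    fix y b
    assume yb: "(y, b) \<in> exts q (Suc (2 * r))" "(y, b) \<notin> ?g ` ends q (Suc r)"
    obtain p s where occ: "occ p ((q \<noteq> b) # y)" "occ s (y @ [b])" and len: "length y = Suc (2 * r)"
      using yb(1) by (auto simp: exts_def factor_def)
    have p: "p = (\<not> s)" using occ_around[OF occ] len assms by simp
    show "(y, b) \<in> ?f ` ends q (Suc r)"
    proof (cases s)
      case False
      obtain z where z: "factor z" "y @ [b] = morph z"
        by (rule occ_False_even[of "y @ [b]"]) (use occ(2) len False in auto)
      then have "z \<noteq> []" by auto
      then have y: "y = butlast (morph z)" "b = (\<not> last z)"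
        using arg_cong[OF z(2), of butlast] arg_cong[OF z(2), of last] by simp_all
      obtain z' where z': "factor z'" "(q \<noteq> b) # y = tl (butlast (morph z'))"
        by (rule occ_True_even[of "(q \<noteq> b) # y"]) (use occ(1) len p False in auto)
      have lz: "length z = Suc r" "length z' = Suc (Suc r)"
        using z z' len by (auto dest!: arg_cong[where f = length])
      then obtain a z'' where z'': "z' = a # z''" "z'' \<noteq> []"
        by (cases z'; cases "tl z'") auto
      have "(\<not> hd z') = (q \<noteq> b)" "butlast (morph (tl z')) = butlast (morph z)"
        using z'(2) unfolding z''(1) y(1)[symmetric] using z''(2) by simp_all
      moreover from this(2) have "tl z' = z"
        by (rule inj_onD[OF inj_on_butlast_morph]) (use lz in \<open>auto simp: tl_Nil\<close>)
      ultimately have "hd z' = (q = b)" "tl z' = z"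
        by auto
      moreover from this(2) have "last z' = last z" using z'' by auto
      ultimately have "z' \<in> ends q (Suc r)" "(y, b) = ?f z'"
        using lz z'(1) y by (auto simp: ends_def)
      then show ?thesis by blast
    next
      case True
      obtain z where z: "factor z" "(q \<noteq> b) # y = morph z"
        by (rule occ_False_even[of "(q \<noteq> b) # y"]) (use occ(1) len p True in auto)
      then have "z \<noteq> []" by auto
      then have y: "y = tl (morph z)" "hd z = (q \<noteq> b)"
        using arg_cong[OF z(2), of tl] arg_cong[OF z(2), of hd] by simp_all
      obtain z' where z': "factor z'" "y @ [b] = tl (butlast (morph z'))"
        by (rule occ_True_even[of "y @ [b]"]) (use occ(2) len True in auto)
      have lz: "length z = Suc r" "length z' = Suc (Suc r)"
        using z z' len by (auto dest!: arg_cong[where f = length])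
      have "butlast z' \<noteq> []" using lz by (cases z' rule: rev_cases) auto
      then have b: "b = last z'" "y = tl (morph (butlast z'))"
        using z'(2) lz by (auto simp: tl_butlast_morph tl_morph butlast_tl hd_butlast')
      have "tl (morph (butlast z')) = tl (morph z)" using y(1) b(2) by simp
      then have "butlast z' = z"
        by (rule inj_onD[OF inj_on_tl_morph]) (use lz \<open>butlast z' \<noteq> []\<close> in auto)
      then have "hd z' = (q \<noteq> b)"
        using y lz using hd_butlast'[of z'] by auto
      then have "z' \<in> ends q (Suc r)" "(y, b) = ?g z'"
        using lz z'(1) b by (auto simp: ends_def)
      then show ?thesis using yb(2) by blast
    qed
  qed
  then have "card (exts q (Suc (2 * r))) \<le> card (?f ` ends q (Suc r) \<union> ?g ` ends q (Suc r))"
    by (intro card_mono) auto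
  also have "\<dots> \<le> card (?f ` ends q (Suc r)) + card (?g ` ends q (Suc r))"
    by (rule card_Un_le)
  also have "\<dots> \<le> card (ends q (Suc r)) + card (ends q (Suc r))"
    by (intro add_mono card_image_le) auto
  finally show ?thesis by simp
qed

section \<open>Linear bounds\<close>

lemma factor_map_tm: "factor (map tm [i..<i + n])"
  unfolding factor_def occ_def by (intro exI[of _ "odd i"] exI[of _ i]) simp

lemma length_le_card_ends:
  assumes "distinct (map (\<lambda>i. map tm [i..<i + Suc m]) I)"
    and "\<forall>i\<in>set I. (tm i \<noteq> tm (i + m)) = q"
  shows "length I \<le> card (ends q m)"
proof -
  have "set (map (\<lambda>i. map tm [i..<i + Suc m]) I) \<subseteq> ends q m"
  proof (clarsimp simp del: upt_Suc)
    fix i assume "i \<in> set I"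
    moreover have "hd (map tm [i..<i + Suc m]) = tm i" "last (map tm [i..<i + Suc m]) = tm (i + m)"
      by (auto simp: hd_map hd_append)
    ultimately show "map tm [i..<Suc (i + m)] \<in> ends q m"
      using assms(2) factor_map_tm[of i "Suc m"] by (simp add: ends_def del: upt_Suc)
  qed
  from card_mono[OF finite_ends this] show ?thesis
    using distinct_card[OF assms(1)] by simp
qed

lemma card_ends_small:
  "2 \<le> card (ends True 1)" "2 \<le> card (ends False 1)"
  "4 \<le> card (ends True 2)" "2 \<le> card (ends False 2)"
  "4 \<le> card (ends True 3)" "6 \<le> card (ends False 3)"
proof -
  show "2 \<le> card (ends True 1)" using length_le_card_ends[of 1 "[0, 2]" True] by simp
  show "2 \<le> card (ends False 1)" using length_le_card_ends[of 1 "[1, 5]" False] tm_Bit0[of num.One] by (simp add: numeral_2_eq_2)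
  show "4 \<le> card (ends True 2)" using length_le_card_ends[of 2 "[4, 5, 12, 13]" True] by simp
  show "2 \<le> card (ends False 2)" using length_le_card_ends[of 2 "[2, 3]" False] by simp
  show "4 \<le> card (ends True 3)" using length_le_card_ends[of 3 "[2, 5, 7, 10]" True] by simp
  show "6 \<le> card (ends False 3)"
    using length_le_card_ends[of 3 "[3, 4, 6, 9, 11, 25]" False] by simp
qed

text \<open>The recurrences start at \<open>r = 2\<close>, so an induction along them has the base
  cases 1, 2 and 3.\<close>

lemma nat_double_cases [consumes 1, case_names 1 2 3 even odd]:
  assumes "1 \<le> (m :: nat)" "m = 1 \<Longrightarrow> P" "m = 2 \<Longrightarrow> P" "m = 3 \<Longrightarrow> P"
    "\<And>r. m = 2 * r \<Longrightarrow> 2 \<le> r \<Longrightarrow> P" "\<And>r. m = Suc (2 * r) \<Longrightarrow> 2 \<le> r \<Longrightarrow> P"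
  shows P
proof (cases "even m")
  case True
  then obtain r where "m = 2 * r" by blast
  then show ?thesis using assms(1,3) assms(5)[of r] by (cases "r = 1") auto
next
  case False
  then obtain r where "m = 2 * r + 1" by (rule oddE)
  then show ?thesis using assms(2,4) assms(6)[of r] by (cases "r = 0"; cases "r = 1") auto
qed

text \<open>The bound on the sum is carried along because the odd case for d rests on it.\<close>

lemma card_ends_bounds:
  assumes "1 \<le> m"
  shows "4 * m \<le> 3 * card (ends True m) \<and> m \<le> card (ends False m)
    \<and> 3 * m \<le> card (ends True m) + card (ends False m)"
  using assms
proof (induction m rule: less_induct)
  case (less m)
  from less.prems show ?case
  proof (cases m rule: nat_double_cases)
    case (even r)
    then show ?thesis using less.IH[of r] card_ends_double[of r True] card_ends_double[of r False]
      by auto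
  next
    case (odd r)
    have step: "card (ends False r) + card (ends False (Suc r)) \<le> card (ends True m)"
      "card (ends True r) + card (ends True (Suc r)) \<le> card (ends False m)"
      using odd card_ends_double_Suc[of r True] card_ends_double_Suc[of r False] by simp_all
    have IH: "4 * k \<le> 3 * card (ends True k) \<and> k \<le> card (ends False k)
      \<and> 3 * k \<le> card (ends True k) + card (ends False k)" if "1 \<le> k" "k \<le> Suc r" for k
      using less.IH[of k] that odd by simp
    \<comment> \<open>The bound e(k) >= k alone gives only 2r + 1 here. Of e(r) and e(r+1), one has
      an even and one an odd index; unfolding both again yields d(s) + d(s+1) plus twice e(s) or
      e(s+1), where s is r/2 rounded down, and the bound on the sum applies.\<close>
    have "4 * m \<le> 3 * (card (ends False r) + card (ends False (Suc r)))"
    proof -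
      have "1 \<le> r" using odd by simp
      then show ?thesis
      proof (cases r rule: nat_double_cases)
        case 2
        then show ?thesis using odd card_ends_small by (simp add: numeral_eq_Suc)
      next
        case 3
        then show ?thesis using odd card_ends_small card_ends_double[of 2 False]
          by (simp add: numeral_eq_Suc)
      next
        case (even s)
        then show ?thesis
          using odd card_ends_double[of s False] card_ends_double_Suc[of s False] IH[of s] IH[of "Suc s"]
          by auto
      next
        case o: (odd s)
        then show ?thesis
          using odd card_ends_double[of "Suc s" False] card_ends_double_Suc[of s False]
            IH[of s] IH[of "Suc s"]
          by auto
      qed (use odd in auto)
    qed
    then show ?thesis using step IH[of r] IH[of "Suc r"] odd by auto
  qed (use card_ends_small in auto)
qed

lemma not_factor_cube_Cons [simp]: "\<not> factor (a # a # a # w)" "\<not> factor (b # a # a # a # w)"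
  using factor_appendD(1)[of "[a, a, a]" w] factor_appendD(2)[of "[b]" "[a, a, a] @ w"] not_factor_cube[of a]
  by auto

text \<open>The listed sets leave out exactly the pairs for which one of the two words contains a
  cube of a letter.\<close>

lemma card_exts_small:
  "card (exts q 1) \<le> 4" "card (exts False 2) \<le> 6" "card (exts True 2) \<le> 4"
  "card (exts False 3) \<le> 8" "card (exts True 3) \<le> 8"
proof -
  have "exts q 1 \<subseteq> {([False], False), ([False], True), ([True], False), ([True], True)}" (is "_ \<subseteq> ?S")
  proof (rule subrelI)
    fix y b
    assume yb: "(y, b) \<in> exts q 1"
    then obtain c where "y = [c]" by (auto simp: exts_def length_Suc_conv numeral_eq_Suc)
    with yb show "(y, b) \<in> ?S"
      by (cases c; cases b; simp add: exts_def)
  qed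
  from card_mono[OF _ this] show "card (exts q 1) \<le> 4" by simp
  have "exts False 2 \<subseteq> {([False, False], True), ([False, True], False), ([False, True], True), ([True, False], False),
      ([True, False], True), ([True, True], False)}" (is "_ \<subseteq> ?S")
  proof (rule subrelI)
    fix y b
    assume yb: "(y, b) \<in> exts False 2"
    then obtain c d where "y = [c, d]" by (auto simp: exts_def length_Suc_conv numeral_eq_Suc)
    with yb show "(y, b) \<in> ?S"
      by (cases c; cases d; cases b; simp add: exts_def)
  qed
  from card_mono[OF _ this] show "card (exts False 2) \<le> 6" by simp
  have "exts True 2 \<subseteq> {([False, True], False), ([False, True], True), ([True, False], False), ([True, False], True)}" (is "_ \<subseteq> ?S")
  proof (rule subrelI)
    fix y b
    assume yb: "(y, b) \<in> exts True 2"
    then obtain c d where "y = [c, d]" by (auto simp: exts_def length_Suc_conv numeral_eq_Suc)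
    with yb show "(y, b) \<in> ?S"
      by (cases c; cases d; cases b; simp add: exts_def)
  qed
  from card_mono[OF _ this] show "card (exts True 2) \<le> 4" by simp
  have "exts False 3 \<subseteq> {([False, False, True], True), ([False, True, False], False), ([False, True, False], True),
      ([False, True, True], False),
      ([True, False, False], True), ([True, False, True], False), ([True, False, True], True), ([True, True, False], False)}" (is "_ \<subseteq> ?S")
  proof (rule subrelI)
    fix y b
    assume yb: "(y, b) \<in> exts False 3"
    then obtain c d e where "y = [c, d, e]" by (auto simp: exts_def length_Suc_conv numeral_eq_Suc)
    with yb show "(y, b) \<in> ?S"
      by (cases c; cases d; cases e; cases b; simp add: exts_def)
  qed
  from card_mono[OF _ this] show "card (exts False 3) \<le> 8" by simp
  have "exts True 3 \<subseteq> {([False, False, True], False), ([False, True, False], False), ([False, True, False], True),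
      ([False, True, True], False),
      ([True, False, False], True), ([True, False, True], False), ([True, False, True], True), ([True, True, False], True)}" (is "_ \<subseteq> ?S")
  proof (rule subrelI)
    fix y b
    assume yb: "(y, b) \<in> exts True 3"
    then obtain c d e where "y = [c, d, e]" by (auto simp: exts_def length_Suc_conv numeral_eq_Suc)
    with yb show "(y, b) \<in> ?S"
      by (cases c; cases d; cases e; cases b; simp add: exts_def)
  qed
  from card_mono[OF _ this] show "card (exts True 3) \<le> 8" by simp
qed

text \<open>The coefficients are fitted to \<open>card_exts_double\<close>: the second bound at
  \<open>r\<close> gives the first at \<open>2 * r\<close> without loss, and the first gives the
  second because 4r <= 2 e(r) + d(r). Odd \<open>m\<close> needs no induction hypothesis.\<close>

lemma card_exts_bounds:
  assumes "1 \<le> m"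
  shows "3 * card (exts True m) + 8 * m \<le> 6 * card (ends False m) + 3 * card (ends True m) + 8
    \<and> 3 * card (exts False m) + 16 * m \<le> 9 * card (ends False m) + 6 * card (ends True m) + 8"
  using assms
proof (induction m rule: less_induct)
  case (less m)
  from less.prems show ?case
  proof (cases m rule: nat_double_cases)
    case (even r)
    then show ?thesis
      using less.IH[of r] card_ends_bounds[of r] card_ends_double[of r True] card_ends_double[of r False]
        card_exts_double[of r True] card_exts_double[of r False]
      by auto
  next
    case (odd r)
    then show ?thesis
      using card_ends_bounds[of r] card_ends_bounds[of "Suc r"]
        card_ends_double_Suc[of r True] card_ends_double_Suc[of r False]
        card_exts_double_Suc[of r True] card_exts_double_Suc[of r False]
      by auto
  qed (use card_ends_small card_exts_small(1)[of True] card_exts_small(1)[of False] card_exts_small(2-)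
      in \<open>simp_all add: numeral_eq_Suc\<close>)
qed

section \<open>Conjugate factors of odd length\<close>

definition inequivalent :: "nat \<Rightarrow> bool list set \<Rightarrow> bool" where
  "inequivalent n S \<longleftrightarrow> (\<forall>x\<in>S. factor x \<and> length x = n)
     \<and> (\<forall>u v. u @ v \<in> S \<longrightarrow> v @ u \<in> S \<longrightarrow> u @ v = v @ u)"

lemma thue_morse_eq_of_bool: "thue_morse i = of_bool (tm i)"
  using thue_morse_le[of i] by (cases "tm i") (auto simp: tm_def)

text \<open>The injection \<open>of_bool\<close> carries Boolean words to words over 0 and 1 and
  commutes with rotation, so inequivalent words land in different classes.\<close>

lemma card_le_tm_cyclic_count:
  assumes "inequivalent n S"
  shows "card S \<le> tm_cyclic_count n"
  unfolding tm_cyclic_count_def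
proof (rule card_inj_on_le[OF _ _ finite_tm_factors_quotient])
  let ?h = "map (of_bool :: bool \<Rightarrow> nat)"
  let ?f = "\<lambda>x. cyclic_equiv `` {?h x}"
  have inj: "inj ?h" by (intro inj_mapI injI) (auto split: if_splits simp: of_bool_def)
  show "inj_on ?f S"
  proof (rule inj_onI)
    fix x y assume xy: "x \<in> S" "y \<in> S" "?f x = ?f y"
    then have "(?h x, ?h y) \<in> cyclic_equiv"
      using eq_equiv_class[OF _ equiv_cyclic_equiv] by blast
    then obtain k where "?h y = rotate k (?h x)"
      using cyclic_equiv_iff_rotate by blast
    then have "y = rotate k x"
      using inj by (metis injD rotate_map)
    then have "y = drop (k mod length x) x @ take (k mod length x) x"
      by (simp add: rotate_drop_take)
    then show "x = y"
      using xy(1,2) assms append_take_drop_id[of "k mod length x" x] unfolding inequivalent_def by metis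
  qed
  show "?f ` S \<subseteq> tm_factors n // cyclic_equiv"
  proof (rule image_subsetI, rule quotientI)
    fix x assume "x \<in> S"
    then obtain i where "map tm [i..<i + n] = x"
      using assms by (auto simp: inequivalent_def factor_def occ_def)
    then have "?h x = map thue_morse [i..<i + n]"
      by (auto simp: thue_morse_eq_of_bool)
    then show "?h x \<in> tm_factors n" by (auto simp: tm_factors_def)
  qed
qed

text \<open>The parity condition says that the cut between \<open>v\<close> and \<open>u\<close>
  falls inside a block.\<close>

lemma occ_junction:
  assumes "occ p (v @ u)" "odd (length v) \<noteq> p" "u \<noteq> []" "v \<noteq> []"
  shows "hd u = (\<not> last v)"
proof -
  obtain v' a where v: "v = v' @ [a]" using assms(4) by (cases v rule: rev_cases) auto
  obtain b u' where u: "u = b # u'" using assms(3) by (cases u) auto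
  have "b = (\<not> a)"
    using assms(1,2) unfolding u v by (intro occ_block_append[of p v' a b u']) auto
  then show ?thesis using u v by simp
qed

lemma occ_False_complete_block:
  assumes "occ False w" "odd (length w)"
  shows "factor (w @ [\<not> last w])"
proof -
  obtain b where b: "occ False (w @ [b])" using assms(1) by (rule occ_extend_right)
  have "w \<noteq> []" using assms(2) by auto
  then have "b = (\<not> last w)" using occ_junction[OF b] assms(2) by simp
  with b show ?thesis by (auto simp: factor_def)
qed

lemma occ_True_complete_block:
  assumes "occ True w" "w \<noteq> []"
  shows "factor ((\<not> hd w) # w)"
proof -
  obtain b where b: "occ False (b # w)" using assms(1) by (rule occ_True_extend_left)
  then have "b = (\<not> hd w)" using assms(2) occ_block[of b "hd w" "tl w"] by auto
  with b show ?thesis by (auto simp: factor_def)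
qed

text \<open>Excluding cubes, \<open>w\<close> begins with \<open>a\<close> and ends with its
  complement. Equal adjacent letters straddle a block boundary, which fixes both alignments; for odd
  length \<open>w\<close> would have both and hence equal end letters.\<close>

lemma factor_insert_middle:
  assumes "factor ((\<not> a) # (\<not> a) # w)" "factor (w @ [a, a])" "w \<noteq> []"
  shows "factor ((\<not> a) # w @ [a])"
proof -
  have hd: "hd w = a"
    using assms(1,3) not_factor_cube_Cons(1)[of "\<not> a" "tl w"]
    by (cases a; cases w; cases "hd w") auto
  have last: "last w = (\<not> a)"
  proof -
    have "factor ((butlast w @ [last w]) @ [a, a])" using assms(2,3) by simp
    then have "factor [last w, a, a]"
      using factor_appendD(2)[of "butlast w" "[last w, a, a]"] by (simp del: append_butlast_last_id)
    then show ?thesis using not_factor_cube[of a] by (cases a; cases "last w") auto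
  qed
  obtain p where p: "occ p ((\<not> a) # (\<not> a) # w)" using assms(1) by (auto simp: factor_def)
  then have "p = True" using occ_block[of "\<not> a" "\<not> a" w] by (cases p) auto
  then have occ1: "occ True w" using occ_Cons[OF occ_Cons[OF p]] by simp
  obtain q where q: "occ q (w @ [a, a])" using assms(2) by (auto simp: factor_def)
  have qlen: "odd (length w) \<noteq> q" using occ_block_append[of q w a a "[]"] q by auto
  show ?thesis
  proof (cases "even (length w)")
    case True
    then have "occ True (w @ [a])"
      using q qlen occ_append(1)[of q "w @ [a]" "[a]"] by simp
    from occ_True_complete_block[OF this] show ?thesis using assms(3) hd by simp
  next
    case False
    then have "occ False w"
      using q qlen occ_append(1)[of q w "[a, a]"] by simp
    then have False
      by (rule occ_both_cases[OF _ occ1]) (use False hd last in auto)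
    then show ?thesis ..
  qed
qed

text \<open>If the two alignments disagree on \<open>u\<close>, then \<open>u\<close> is alternating, hence of length at most 4.\<close>

lemma factor_rotate1_aux:
  assumes occ: "occ p (u @ v)" "occ (p \<noteq> odd (length u)) (v @ u)"
    and odd: "odd (length (u @ v))" and ne: "u \<noteq> []" "v \<noteq> []"
  shows "factor (rotate1 (u @ v))"
proof -
  have "occ p u" "occ (\<not> p) u"
    using occ_append(1)[OF occ(1)] occ_append(2)[OF occ(2)] odd by auto
  then have both: "occ False u" "occ True u" by (cases p; simp)+
  \<comment> \<open>\<open>u @ v\<close> ends inside a block, so its next letter is forced; the
    junction in \<open>v @ u\<close> shows that this letter is \<open>a\<close>.\<close>
  have r1: ?thesis if u: "u = [a, \<not> a] \<or> u = [a, \<not> a, a]" and "\<not> p" for a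
  proof -
    have "last v = (\<not> a)"
      using occ_junction[OF occ(2)] odd ne u \<open>\<not> p\<close> by auto
    then have "factor ((u @ v) @ [a])"
      using occ_False_complete_block[of "u @ v"] occ(1) odd ne \<open>\<not> p\<close> by simp
    then show ?thesis using u factor_tl[of "(u @ v) @ [a]"] by auto
  qed
  \<comment> \<open>Now \<open>v @ u\<close> starts inside a block, and the letter before it is
    forced.\<close>
  have r2: ?thesis if u: "u = [a, \<not> a]" and p for a
  proof -
    have "hd v = a"
      using occ_junction[OF occ(1)] odd ne u \<open>p\<close> by auto
    then have "factor ((\<not> a) # v @ u)"
      using occ_True_complete_block[of "v @ u"] occ(2) ne u \<open>p\<close> by simp
    then show ?thesis using u factor_butlast[of "(\<not> a) # v @ u"] by (simp add: butlast_append)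
  qed
  \<comment> \<open>With \<open>v = morph w\<close>, the two given words and the goal come from
    \<open>(\<not> a) # (\<not> a) # w\<close>, \<open>w @ [a, a]\<close> and
    \<open>(\<not> a) # w @ [a]\<close>.\<close>
  have r3: ?thesis if u: "u = [a, \<not> a, a]" and p for a
  proof -
    have "even (length v)" using odd u by simp
    have "occ False v" using occ_append(1)[OF occ(2)] u \<open>p\<close> by simp
    then obtain w where w: "v = morph w" "factor w"
      by (rule occ_False_even) (use \<open>even (length v)\<close> in auto)
    have "w \<noteq> []" using w(1) ne(2) by auto
    obtain z where z: "factor z" "u @ v = tl (morph z)"
      by (rule occ_True_odd[of "u @ v"]) (use occ odd \<open>p\<close> in auto)
    have zw: "z = (\<not> a) # (\<not> a) # w"
      using z(2) u w(1) by (cases z; cases "tl z") auto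
    obtain y where y: "factor y" "v @ u = butlast (morph y)"
      by (rule occ_False_odd[of "v @ u"]) (use occ odd u \<open>p\<close> in auto)
    have "y \<noteq> []" using y(2) ne by auto
    have vu: "v @ u = morph (butlast y) @ [last y]"
      using y(2) butlast_morph[OF \<open>y \<noteq> []\<close>] by (rule trans)
    have "morph (w @ [a]) @ [a] = v @ u" using u w(1) by simp
    then have "morph (w @ [a]) @ [a] = morph (butlast y) @ [last y]" using vu by (rule trans)
    then have eq: "w @ [a] = butlast y \<and> a = last y" unfolding append1_eq_conv morph_inject .
    have "y = butlast y @ [last y]" using \<open>y \<noteq> []\<close> by simp
    also have "\<dots> = (w @ [a]) @ [a]"
      unfolding conjunct1[OF eq, symmetric] conjunct2[OF eq, symmetric] by (rule refl)
    finally have yw: "y = (w @ [a]) @ [a]" .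
    have "factor ((\<not> a) # (\<not> a) # w)" using z(1) unfolding zw .
    moreover have "factor (w @ [a, a])" using y(1) unfolding yw by simp
    ultimately have "factor ((\<not> a) # w @ [a])"
      using \<open>w \<noteq> []\<close> by (rule factor_insert_middle)
    then have "factor (butlast (morph ((\<not> a) # w @ [a])))"
      by (intro factor_butlast factor_morph)
    then show ?thesis using u w(1) by (simp add: butlast_append)
  qed
  \<comment> \<open>The letter of \<open>v\<close> at the junction would prolong \<open>u\<close> to
    a forbidden alternating word.\<close>
  have r4: False if u: "u = [a, \<not> a, a, \<not> a]" for a
  proof (cases p)
    case False
    have "last v = (\<not> a)"
      using occ_junction[OF occ(2)] odd ne u False by auto
    then have "butlast v @ [\<not> a] = v" using append_butlast_last_id[OF ne(2)] by simp
    then have "factor ((butlast v @ [\<not> a]) @ u)" using occ(2) by (auto simp: factor_def)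
    then have "factor [\<not> a, a, \<not> a, a, \<not> a]" using u factor_appendD(2)[of "butlast v"] by simp
    then show False using not_factor_alternating[of "\<not> a"] by simp
  next
    case True
    have "hd v = a"
      using occ_junction[OF occ(1)] odd ne u True by auto
    then have "a # tl v = v" using ne(2) by (cases v) auto
    then have "factor (u @ a # tl v)" using occ(1) by (auto simp: factor_def)
    then have "factor [a, \<not> a, a, \<not> a, a]"
      using u factor_appendD(1)[of "[a, \<not> a, a, \<not> a, a]" "tl v"] by simp
    then show False using not_factor_alternating[of a] by simp
  qed
  have r5: ?thesis if "u = [a]" for a
    using occ(2) that by (auto simp: factor_def)
  from both show ?thesis
  proof (rule occ_both_cases)
    fix a assume u: "u = [a, \<not> a]"
    show ?thesis using r1[of a] r2[of a] u by blast
  next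
    fix a assume u: "u = [a, \<not> a, a]"
    show ?thesis using r1[of a] r3[of a] u by blast
  qed (use ne(1) r4 r5 in blast)+
qed

text \<open>As the length is odd, the alignments agree on exactly one of \<open>u\<close> and
  \<open>v\<close>; \<open>factor_rotate1_aux\<close> covers agreement on \<open>v\<close>, and the
  other case is symmetric.\<close>

lemma factor_rotate1:
  assumes "factor (u @ v)" "factor (v @ u)" "odd (length (u @ v))" "u \<noteq> []" "v \<noteq> []"
  shows "factor (rotate1 (u @ v)) \<or> factor (rotate1 (v @ u))"
proof -
  obtain p q where pq: "occ p (u @ v)" "occ q (v @ u)" using assms(1,2) by (auto simp: factor_def)
  show ?thesis
  proof (cases "q = (p \<noteq> odd (length u))")
    case True
    have "occ (p \<noteq> odd (length u)) (v @ u)" using pq(2) unfolding True .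
    then show ?thesis using factor_rotate1_aux[OF pq(1) _ assms(3-5)] by blast
  next
    case False
    then have p: "p = (q \<noteq> odd (length v))" using assms(3) by auto
    have "occ (q \<noteq> odd (length v)) (u @ v)" using pq(1) unfolding p .
    moreover have "odd (length (v @ u))" using assms(3) by simp
    ultimately show ?thesis using factor_rotate1_aux[OF pq(2) _ _ assms(5,4)] by blast
  qed
qed

section \<open>Inequivalent factors\<close>

lemma exists_inequivalent_odd:
  assumes "2 \<le> m"
  shows "\<exists>S. inequivalent (Suc (2 * m)) S \<and> 4 * Suc (2 * m) \<le> 3 * card S + 12"
proof -
  let ?n = "Suc (2 * m)"
  define W where "W = {x. factor x \<and> length x = ?n}"
  define R where "R = {x \<in> W. factor (rotate1 x)}"
  have W: "W = ends True (2 * m) \<union> ends False (2 * m)" "ends True (2 * m) \<inter> ends False (2 * m) = {}"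
    by (auto simp: W_def ends_def)
  then have fin: "finite W" "finite R" by (auto simp: R_def)
  have cardW: "card W = card (ends True (2 * m)) + card (ends False (2 * m))"
    unfolding W(1) by (rule card_Un_disjoint) (use W(2) in auto)
  have cardR: "card R \<le> card (exts False (2 * m))"
  proof (rule card_inj_on_le)
    show "inj_on (\<lambda>x. (tl x, hd x)) R"
    proof (rule inj_onI)
      fix x y assume "x \<in> R" "y \<in> R" "(tl x, hd x) = (tl y, hd y)"
      then show "x = y" by (cases x; cases y) (auto simp: R_def W_def)
    qed
    show "(\<lambda>x. (tl x, hd x)) ` R \<subseteq> exts False (2 * m)"
    proof (rule image_subsetI)
      fix x assume "x \<in> R"
      then show "(tl x, hd x) \<in> exts False (2 * m)"
        by (cases x) (auto simp: R_def W_def exts_def)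
    qed
  qed simp
  \<comment> \<open>With d, e at \<open>m\<close> and f for \<open>card (exts True m)\<close>, three
    times \<open>card (W - R)\<close> is at least 6(d + e) - 3(f + d), and the bound on f leaves 8m
    - 8.\<close>
  have "card W = card (W - R) + card R"
    using fin by (subst card_Un_disjoint[symmetric]) (auto simp: R_def intro: arg_cong[where f = card])
  moreover have "card (exts False (2 * m)) \<le> card (exts True m) + card (ends True m)"
    using card_exts_double[of m False] assms by simp
  moreover have "3 * card (exts True m) + 8 * m \<le> 6 * card (ends False m) + 3 * card (ends True m) + 8"
    using card_exts_bounds[of m] assms by simp
  ultimately have "8 * m \<le> 3 * card (W - R) + 8"
    using cardW cardR card_ends_double[OF assms, of True] card_ends_double[OF assms, of False]
    by linarith
  then have "4 * ?n \<le> 3 * card (W - R) + 12" by simp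
  moreover have "inequivalent ?n (W - R)"
    unfolding inequivalent_def
  proof (intro conjI ballI allI impI)
    fix u v assume "u @ v \<in> W - R" "v @ u \<in> W - R"
    then show "u @ v = v @ u"
      using factor_rotate1[of u v] by (cases "u = [] \<or> v = []") (auto simp: W_def R_def)
  qed (auto simp: W_def)
  ultimately show ?thesis by blast
qed

text \<open>As the length is even, alignments that disagree on one part disagree on both, so each
  part has length at most 4.\<close>

lemma occ_swap:
  assumes "occ p (u @ v)" "occ q (v @ u)" "even (length (u @ v))" "8 < length (u @ v)"
  shows "q = (p \<noteq> odd (length u))"
proof (rule ccontr)
  assume q: "q \<noteq> (p \<noteq> odd (length u))"
  have "occ p u" "occ (p \<noteq> odd (length u)) v" "occ q v" "occ (q \<noteq> odd (length v)) u"
    using occ_append[OF assms(1)] occ_append[OF assms(2)] by auto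
  moreover have "(q \<noteq> odd (length v)) = (\<not> p)" using q assms(3) by auto
  moreover have "q = (\<not> (p \<noteq> odd (length u)))" using q by blast
  ultimately have "length u \<le> 4" "length v \<le> 4"
    using occ_both_length[of u] occ_both_length[of v] by (cases p; cases q; simp)+
  with assms(4) show False by simp
qed

text \<open>Different end letters of \<open>z\<close> make \<open>hd u\<close> and
  \<open>last v\<close> equal, but a cut inside a block makes them complementary.\<close>

lemma not_occ_swap:
  assumes "tl (butlast (morph z)) = u @ v" "z \<in> ends True m" "1 \<le> m"
    "occ q (v @ u)" "odd (length v) \<noteq> q" "u \<noteq> []" "v \<noteq> []"
  shows False
proof -
  have z: "2 \<le> length z" "hd z \<noteq> last z" using assms(2,3) by (auto simp: ends_def)
  have "hd (u @ v) = (\<not> hd z)" "last (u @ v) = last z"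
    using z(1) unfolding assms(1)[symmetric] by (simp_all add: tl_butlast_morph)
  then have "hd u = last v" using z(2) assms(6,7) by auto
  then show False using occ_junction[OF assms(4-7)] by simp
qed

text \<open>A word \<open>tl (butlast (morph z))\<close> with \<open>z \<in> ends True m\<close> is alone in its class: by \<open>not_occ_swap\<close>
  no proper rotation of it is a factor with a compatible alignment.\<close>

lemma exists_inequivalent_double:
  assumes "5 \<le> m" and R: "inequivalent m R" "finite R"
  shows "\<exists>S. inequivalent (2 * m) S \<and> card S = card R + card (ends True m)"
proof -
  let ?t = "\<lambda>z. tl (butlast (morph z))"
  let ?S = "morph ` R \<union> ?t ` ends True m"
  have Rx: "factor x" "length x = m" if "x \<in> R" for x
    using that R(1) by (auto simp: inequivalent_def)
  have Ez: "factor z" "length z = Suc m" if "z \<in> ends True m" for z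
    using that by (auto simp: ends_def)
  have occR: "occ False (morph x)" if "x \<in> R" for x using Rx[OF that] by simp
  have occE: "occ True (?t z)" if "z \<in> ends True m" for z
    using Ez[OF that] by (intro factor_imp_occ_tl_butlast) auto
  \<comment> \<open>Opposite alignments force \<open>u\<close> and \<open>v\<close> to have odd
    length, so the junction of \<open>v @ u\<close> lies inside a block.\<close>
  have mixed: False if "z \<in> ends True m" "?t z = u @ v" "y \<in> R" "morph y = v @ u" for u v z y
  proof -
    have "length (u @ v) = 2 * m" using Ez[OF that(1)] that(2)[symmetric] by simp
    then have len: "even (length (u @ v))" "8 < length (u @ v)" using assms(1) by simp_all
    have occ: "occ True (u @ v)" "occ False (v @ u)"
      using occE[OF that(1)] occR[OF that(3)] that(2,4) by simp_all
    then have "odd (length u)" using occ_swap[OF occ len] by simp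
    moreover from this have "odd (length v)" using len(1) by simp
    moreover from calculation have "u \<noteq> []" "v \<noteq> []" by auto
    ultimately show False
      using not_occ_swap[OF that(2,1) _ occ(2)] assms(1) by auto
  qed
  have S: "factor w" "length w = 2 * m" if "w \<in> ?S" for w
    using that Rx Ez by (auto intro!: factor_morph factor_tl factor_butlast)
  have "inequivalent (2 * m) ?S"
    unfolding inequivalent_def
  proof (intro conjI ballI allI impI)
    fix u v assume uv: "u @ v \<in> ?S" "v @ u \<in> ?S"
    from S(2)[OF uv(1)] have len: "even (length (u @ v))" "8 < length (u @ v)"
      using assms(1) by simp_all
    from uv consider (RR) x y where "x \<in> R" "u @ v = morph x" "y \<in> R" "v @ u = morph y"
      | (EE) z where "z \<in> ends True m" "u @ v = ?t z" "occ True (v @ u)"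
      | (ER) z y where "z \<in> ends True m" "u @ v = ?t z" "y \<in> R" "v @ u = morph y"
      | (RE) z y where "z \<in> ends True m" "v @ u = ?t z" "y \<in> R" "u @ v = morph y"
      using occE by (elim UnE imageE) metis+
    then show "u @ v = v @ u"
    proof cases
      case RR
      have occ: "occ False (u @ v)" "occ False (v @ u)" using RR occR by metis+
      \<comment> \<open>The cut is at a block boundary, so the conjugacy descends to
        \<open>x\<close> and \<open>y\<close>.\<close>
      then have ev: "even (length u)" using occ_swap[OF occ len] by simp
      have ou: "occ False u" using occ_append(1)[OF occ(1)] .
      have ov: "occ False v" using occ_append(1)[OF occ(2)] .
      obtain u' where u': "u = morph u'" using ou ev by (rule occ_False_even)
      obtain v' where v': "v = morph v'" by (rule occ_False_even[OF ov]) (use ev len(1) in auto)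
      have "morph x = morph (u' @ v')" "morph y = morph (v' @ u')" using RR(2,4) u' v' by simp_all
      then have "x = u' @ v'" "y = v' @ u'" by (simp_all only: morph_inject)
      then have "u' @ v' = v' @ u'" using RR(1,3) R(1) by (simp add: inequivalent_def)
      then show ?thesis using u' v' by (metis morph_append)
    next
      case EE
      have occ: "occ True (u @ v)" "occ True (v @ u)" using EE occE by metis+
      then have "even (length u)" using occ_swap[OF occ len] by simp
      then have "even (length v)" using len(1) by simp
      show ?thesis
      proof (rule ccontr)
        assume "u @ v \<noteq> v @ u"
        then have "u \<noteq> []" "v \<noteq> []" by auto
        then show False
          using not_occ_swap[OF EE(2)[symmetric] EE(1) _ occ(2)] \<open>even (length v)\<close> assms(1) by simp
      qed
    next
      case ER
      then show ?thesis using mixed[of z u v y] by simp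
    next
      case RE
      then show ?thesis using mixed[of z v u y] by simp
    qed
  qed (use S in blast)+
  moreover have "card ?S = card R + card (ends True m)"
  proof -
    have "inj_on morph R" by (rule inj_onI) simp
    moreover have "inj_on ?t (ends True m)"
      by (rule inj_on_subset[OF inj_on_tl_butlast_morph]) (use assms(1) Ez in auto)
    moreover have "morph ` R \<inter> ?t ` ends True m = {}"
    proof (rule ccontr)
      assume "morph ` R \<inter> ?t ` ends True m \<noteq> {}"
      then obtain x z where xz: "x \<in> R" "z \<in> ends True m" "morph x = ?t z" by blast
      then have "length (morph x) \<le> 4" using occ_both_length occR occE by metis
      then show False using Rx(2)[OF xz(1)] assms(1) by simp
    qed
    ultimately show ?thesis using R(2) by (simp add: card_Un_disjoint card_image)
  qed
  ultimately show ?thesis by blast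
qed

text \<open>Bounded quantification over lists makes both premises checkable by simplification for
  concrete \<open>n\<close> and \<open>I\<close>.\<close>

lemma exists_inequivalent_small:
  assumes "distinct (map (\<lambda>i. map tm [i..<i + n]) I)"
    and "list_all (\<lambda>x. list_all (\<lambda>k. rotate k x \<in> set (map (\<lambda>i. map tm [i..<i + n]) I)
      \<longrightarrow> rotate k x = x) [0..<n]) (map (\<lambda>i. map tm [i..<i + n]) I)"
  shows "\<exists>S. inequivalent n S \<and> length I \<le> card S"
proof -
  let ?S = "set (map (\<lambda>i. map tm [i..<i + n]) I)"
  have "inequivalent n ?S"
    unfolding inequivalent_def
  proof (intro conjI ballI allI impI)
    fix x assume "x \<in> ?S"
    then show "factor x" "length x = n" using factor_map_tm by auto
  next
    fix u v assume uv: "u @ v \<in> ?S" "v @ u \<in> ?S"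
    then obtain i where "u @ v = map tm [i..<i + n]" by auto
    from arg_cong[OF this, of length] have len: "length u + length v = n" by simp
    show "u @ v = v @ u"
    proof (cases "length u < n")
      case True
      then have "length u \<in> set [0..<n]" by simp
      with assms(2) uv(1)
      have "rotate (length u) (u @ v) \<in> ?S \<longrightarrow> rotate (length u) (u @ v) = u @ v"
        unfolding list_all_iff by blast
      then show ?thesis using uv(2) by (simp add: rotate_append)
    next
      case False
      with len have "length v = 0" by linarith
      then show ?thesis by simp
    qed
  qed
  moreover have "card ?S = length I" using distinct_card[OF assms(1)] by simp
  ultimately show ?thesis by (metis order_refl)
qed

theorem theorem5:
  fixes n :: nat
  shows "real (tm_cyclic_count n) \<ge> 4 / 3 * real n - 4"
proof -
  \<comment> \<open>The set itself goes through the induction, since the even case applies the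
    morphism to its members.\<close>
  have "\<exists>S. inequivalent n S \<and> 4 * n \<le> 3 * card S + 12"
  proof (induction n rule: less_induct)
    case (less n)
    have empty: "inequivalent n {}" by (simp add: inequivalent_def)
    show ?case
    proof (cases "even n")
      case True
      then obtain m where n: "n = 2 * m" by (rule evenE)
      show ?thesis
      proof (cases "5 \<le> m")
        case True
        then obtain R where R: "inequivalent m R" "4 * m \<le> 3 * card R + 12"
          using less.IH[of m] n by auto
        have "finite R"
          by (rule finite_subset[OF _ finite_length_eq[of m]]) (use R(1) in \<open>auto simp: inequivalent_def\<close>)
        from exists_inequivalent_double[OF True R(1) this]
        obtain S where "inequivalent (2 * m) S" "card S = card R + card (ends True m)" by blast
        then show ?thesis using R(2) n True card_ends_bounds[of m] by (intro exI[of _ S]) auto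
      next
        case False
        then have "n \<le> 2 \<or> n = 4 \<or> n = 6 \<or> n = 8" using n by presburger
        then consider "n \<le> 2" | "n = 4" | "n = 6" | "n = 8" by blast
        then show ?thesis
        proof cases
          \<comment> \<open>Up to length 3 the bound is not positive, so the empty set is
            enough.\<close>
          case 1
          then show ?thesis using empty by (intro exI[of _ "{}"]) auto
        next
          case 2
          \<comment> \<open>The lists give starting positions of just as many factors as the bound
            demands: 2, 4 and 7 for lengths 4, 6 and 8.\<close>
          have "\<exists>S. inequivalent 4 S \<and> length [2 :: nat, 3] \<le> card S"
            by (rule exists_inequivalent_small) (simp_all add: rotate_drop_take upt_conv_Cons)
          then show ?thesis using 2 by auto
        next
          case 3
          have "\<exists>S. inequivalent 6 S \<and> length [2 :: nat, 5, 6, 11] \<le> card S"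
            by (rule exists_inequivalent_small) (simp_all add: rotate_drop_take upt_conv_Cons)
          then show ?thesis using 3 by auto
        next
          case 4
          have "\<exists>S. inequivalent 8 S \<and> length [2 :: nat, 3, 4, 5, 6, 7, 8] \<le> card S"
            by (rule exists_inequivalent_small) (simp_all add: rotate_drop_take upt_conv_Cons)
          then show ?thesis using 4 by auto
        qed
      qed
    next
      case False
      then obtain m where n: "n = 2 * m + 1" by (rule oddE)
      show ?thesis
      proof (cases "2 \<le> m")
        case True
        then show ?thesis using exists_inequivalent_odd[of m] n by simp
      next
        case False
        then show ?thesis using empty n by (intro exI[of _ "{}"]) auto
      qed
    qed
  qed
  then obtain S where "inequivalent n S" "4 * n \<le> 3 * card S + 12" by blast
  with card_le_tm_cyclic_count[of n S] have "4 * n \<le> 3 * tm_cyclic_count n + 12" by linarith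
  then have "4 * real n \<le> 3 * real (tm_cyclic_count n) + 12" by linarith
  then show ?thesis by simp
qed

end
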